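(* Let $x,y\in[0,\infty)^n$. The following three conditions are equivalent: (a) $x\prec_\infty y$; (b) $\displaystyle\sup_{z\in[0,\infty)^n,\ \|z\|_1=1}\ \prod_{i=1}^n(z_i+tx_i)\ \le\ \sup_{z\in[0,\infty)^n,\ \|z\|_1=1}\ \prod_{i=1}^n(z_i+ty_i)$ for all $t>0$; (c) $x\prec_L y$.
   Context: Norms are with respect to normalized counting measure: for $h\in[0,\infty)^n$, $\|h\|_1=\frac1n\sum_{i=1}^n h_i$, $\|h\|_\infty=\max_i h_i$, $\|h\|_0=\left(\prod_{i=1}^n h_i\right)^{1/n}$. For $x\in[0,\infty)^n$ and $t\ge0$, $$I_\infty(x,t)=\inf\left\{\frac1n\sum_{i=1}^n h_ix_i:\ h\in[0,\infty)^n,\ \|h\|_\infty\le1+t,\ \|h\|_0=1\right\}.$$ Relation $\prec_\infty$ on $[0,\infty)^n$: $x\prec_\infty y$ iff $I_\infty(x,t)\le I_\infty(y,t)$ for all $t\ge0$. Relation $\prec_L$ on $[0,\infty)^n$: $x\prec_L y$ iff $\sum_{i=1}^n\psi(x_i)\le\sum_{i=1}^n\psi(y_i)$ for every (finite-valued) function $\psi:[0,\infty)\to[0,\infty)$ of the form $\psi(s)=\int_0^s\varphi(t)\frac{dt}{t}$ for some nondecreasing concave $\varphi:[0,\infty)\to[0,\infty)$. *)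

theory Defs
  imports "HOL-Analysis.Analysis"
begin

definition nonneg_vecs :: "(real ^ 'n) set" where
  "nonneg_vecs = {x. \<forall>i. 0 \<le> x $ i}"

(* Norms with respect to the normalized counting measure on the index type,
   used only for vectors in nonneg_vecs (so no absolute values appear). *)

definition norm_one :: "real ^ 'n \<Rightarrow> real" where
  "norm_one h = (\<Sum>i\<in>UNIV. h $ i) / real CARD('n)"

definition norm_infty :: "real ^ 'n \<Rightarrow> real" where
  "norm_infty h = Max (range (\<lambda>i. h $ i))"

definition norm_zero :: "real ^ 'n \<Rightarrow> real" where
  "norm_zero h = root CARD('n) (\<Prod>i\<in>UNIV. h $ i)"

definition I_infty :: "real ^ 'n \<Rightarrow> real \<Rightarrow> real" where
  "I_infty x t = Inf {(\<Sum>i\<in>UNIV. h $ i * x $ i) / real CARD('n) | h.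
     h \<in> nonneg_vecs \<and> norm_infty h \<le> 1 + t \<and> norm_zero h = 1}"

definition prec_infty :: "real ^ 'n \<Rightarrow> real ^ 'n \<Rightarrow> bool" (infix "\<prec>\<^sub>\<infinity>" 50) where
  "x \<prec>\<^sub>\<infinity> y \<longleftrightarrow> (\<forall>t\<ge>0. I_infty x t \<le> I_infty y t)"

(* The integrability clause expresses that psi is finite-valued: phi / t is nonnegative and,
   phi being monotone, automatically measurable on (0, s].  Nonnegativity of psi on [0, oo)
   follows from that of phi.  Only the values of phi and psi on [0, oo) matter. *)
definition log_primitive :: "(real \<Rightarrow> real) \<Rightarrow> bool" where
  "log_primitive \<psi> \<longleftrightarrow> (\<exists>\<phi>::real \<Rightarrow> real.
     (\<forall>t\<ge>0. 0 \<le> \<phi> t) \<and> mono_on {0..} \<phi> \<and> concave_on {0..} \<phi> \<and>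
     (\<forall>s\<ge>0. set_integrable lborel {0<..s} (\<lambda>t. \<phi> t / t) \<and>
        \<psi> s = (LBINT t:{0<..s}. \<phi> t / t)))"

definition prec_L :: "real ^ 'n \<Rightarrow> real ^ 'n \<Rightarrow> bool" (infix "\<prec>\<^sub>L" 50) where
  "x \<prec>\<^sub>L y \<longleftrightarrow>
     (\<forall>\<psi>. log_primitive \<psi> \<longrightarrow> (\<Sum>i\<in>UNIV. \<psi> (x $ i)) \<le> (\<Sum>i\<in>UNIV. \<psi> (y $ i)))"

definition sup_prod :: "real ^ 'n \<Rightarrow> real \<Rightarrow> real" where
  "sup_prod x t = (SUP z\<in>{z. z \<in> nonneg_vecs \<and> norm_one z = 1}. \<Prod>i\<in>UNIV. (z $ i + t * x $ i))"

(* The real-valued Inf and Sup above are taken over nonempty sets that are bounded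
   in the relevant direction, so they are the true infimum and supremum. *)

lemma one_vec_feasible:
  assumes "0 \<le> t"
  shows "(1 :: real ^ 'n) \<in> nonneg_vecs" "norm_infty (1 :: real ^ 'n) \<le> 1 + t"
    "norm_zero (1 :: real ^ 'n) = 1" "norm_one (1 :: real ^ 'n) = 1"
  using assms by (simp_all add: nonneg_vecs_def norm_infty_def norm_zero_def norm_one_def)

lemma I_infty_bdd_below:
  fixes x :: "real ^ 'n"
  assumes "x \<in> nonneg_vecs"
  shows "bdd_below {(\<Sum>i\<in>UNIV. h $ i * x $ i) / real CARD('n) | h.
     h \<in> nonneg_vecs \<and> norm_infty h \<le> 1 + t \<and> norm_zero h = 1}"
  using assms
  by (intro bdd_belowI[where m = 0]) (auto simp: nonneg_vecs_def intro!: sum_nonneg divide_nonneg_nonneg)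

lemma sup_prod_bdd_above:
  fixes x :: "real ^ 'n"
  assumes "x \<in> nonneg_vecs" "0 \<le> t"
  shows "bdd_above ((\<lambda>z. \<Prod>i\<in>UNIV. (z $ i + t * x $ i)) ` {z. z \<in> nonneg_vecs \<and> norm_one z = 1})"
proof (rule bdd_aboveI2)
  fix z :: "real ^ 'n" assume "z \<in> {z. z \<in> nonneg_vecs \<and> norm_one z = 1}"
  then have z: "\<And>i. 0 \<le> z $ i" "(\<Sum>i\<in>UNIV. z $ i) = real CARD('n)"
    by (auto simp: nonneg_vecs_def norm_one_def)
  have "z $ i \<le> real CARD('n)" for i
    using member_le_sum[of i UNIV "\<lambda>i. z $ i"] z by simp
  then show "(\<Prod>i\<in>UNIV. (z $ i + t * x $ i)) \<le> (\<Prod>i\<in>UNIV. (real CARD('n) + t * x $ i))"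
    using z assms by (intro prod_mono) (auto simp: nonneg_vecs_def)
qed

end

theory Submission imports Defs begin

text \<open>
  All three relations are shown to be equivalent to one comparison: for every $c > 0$,
  $\sum_i K_c(x_i) \le \sum_i K_c(y_i)$, where
  $K_c(s) = \int_0^s \min(t,c)\,dt/t = \min(s,c) + c \log(\max(s,c)/c)$.
  Up to limits, every continuous nondecreasing concave function on $[0,\infty)$ that vanishes at $0$
  is a nonnegative combination of functions $\min(\cdot, c)$. That makes the $K_c$ the right test
  functions for \<open>\<prec>\<^sub>L\<close>. The other two conditions bring in the same functions
  through convex duality, with $c$ as a rescaled Lagrange multiplier.

  For \<open>I_infty\<close>, minimizing $\sum_i h_i x_i$ under $\sum_i \log h_i = 0$ and
  $h_i \le T = 1 + t$ has the dual problem of maximizing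
  $T\,(\sum_i K_c(x_i) - n c \log T)$ over $c > 0$. The optimal $h$ is
  $h_i = T c / \max(x_i, c)$, with $c$ fixed by $\prod_i h_i = 1$. For \<open>sup_prod\<close>, maximizing
  $\sum_i \log(z_i + t x_i)$ under $\sum_i z_i = n$ is water filling: the optimum has
  $z_i + t x_i = t \max(x_i, c)$, and the dual objective depends on $x$ only through
  $c^{-1} \sum_i K_c(x_i)$. In both cases the dual bound holds for every $c$ and every vector
  (\<open>I_infty_ge_dual\<close>, \<open>sup_prod_le_dual\<close>), and is attained for a suitable pairing of
  $c$ and $t$ (\<open>I_infty_eq_dual\<close>, \<open>sup_prod_ge_dual\<close>). To compare optimal values at a
  given $t$, one chooses $c$ optimal for $t$ and one of the two vectors; to extract the inequality
  at a given $c$, one chooses $t$ such that $c$ is optimal. The latter is impossible in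
  \<open>sup_prod\<close> when every $x_i \ge c$, where letting $t \to \infty$ takes its place.

  For \<open>\<prec>\<^sub>L\<close>, each $K_c$ is admissible as \<open>\<psi>\<close>. Conversely, a general
  \<open>\<phi>\<close> is approximated from below by its piecewise linear interpolants, which are nonnegative
  combinations of functions $\min(\cdot, c)$, by an Abel summation
  (\<open>sum_integral_interpolant_mono\<close>); dominated convergence gives the limit
  (\<open>integral_interpolant_tendsto\<close>).
\<close>

section \<open>Truncated logarithms\<close>

text \<open>
  The function $s \mapsto \int_0^s \min(t,c)\,dt/t$ in closed form; see
  \<open>integral_min_over_id\<close>.
\<close>

definition trunc_log :: "real \<Rightarrow> real \<Rightarrow> real" where
  "trunc_log c s = min s c + c * ln (max s c / c)"

definition trunc_log_le :: "real ^ 'n \<Rightarrow> real ^ 'n \<Rightarrow> bool" where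
  "trunc_log_le x y \<longleftrightarrow>
     (\<forall>c>0. (\<Sum>i\<in>UNIV. trunc_log c (x $ i)) \<le> (\<Sum>i\<in>UNIV. trunc_log c (y $ i)))"

section \<open>Duality for the constrained infimum\<close>

text \<open>
  The Lagrangian of one coordinate in the minimization that defines \<open>I_infty\<close>, with
  $r = h_i/(1+t)$. For $s \le c$ the minimum of the convex right-hand side over $(0,1]$ is at
  $r = 1$, otherwise at $r = c/s$; both cases come down to $\log u \le u - 1$.
\<close>
lemma trunc_log_le_linear_minus_ln:
  assumes "0 < c" "0 \<le> s" "0 < r" "r \<le> 1"
  shows "trunc_log c s \<le> r * s - c * ln r"
proof (cases "s \<le> c")
  case True
  have "s * (1 - r) \<le> c * (1 - r)"
    using True assms by (intro mult_right_mono) auto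
  also have "\<dots> \<le> c * (- ln r)"
    using assms ln_le_minus_one[of r] by (intro mult_left_mono) auto
  finally show ?thesis
    using True assms by (simp add: trunc_log_def algebra_simps)
next
  case False
  define u where "u = r * s / c"
  have u: "0 < u" using assms False by (simp add: u_def)
  have "c * ln u \<le> c * (u - 1)"
    using assms ln_le_minus_one[OF u] by (intro mult_left_mono) auto
  moreover have "ln u = ln r + ln (s / c)"
  proof -
    have "u = r * (s / c)" by (simp add: u_def)
    then show ?thesis using assms False by (simp only:) (intro ln_mult_pos, auto)
  qed
  moreover have "c * (ln r + ln (s / c)) = c * ln r + c * ln (s / c)" by (rule distrib_left)
  moreover have "c * (u - 1) = r * s - c" using assms by (simp add: u_def field_simps)
  moreover have "trunc_log c s = c + c * ln (s / c)" using False by (simp add: trunc_log_def)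
  ultimately show ?thesis by simp
qed

lemma trunc_log_eq_linear_minus_ln:
  assumes "0 < c" "0 \<le> s"
  shows "trunc_log c s = (c / max s c) * s - c * ln (c / max s c)"
  using assms by (auto simp: trunc_log_def max_def min_def ln_div algebra_simps)

text \<open>
  Weak duality: a feasible $h$ has $\prod_i h_i = 1$, so subtracting $(1+t)\, c \sum_i \log h_i = 0$
  from the objective changes nothing, and the coordinates can then be bounded separately.
\<close>
lemma I_infty_ge_dual:
  fixes x :: "real ^ 'n" and c t :: real
  assumes x: "x \<in> nonneg_vecs" and c: "0 < c" and t: "0 \<le> t"
  shows "(1 + t) * ((\<Sum>i\<in>UNIV. trunc_log c (x $ i)) - CARD('n) * c * ln (1 + t))
           \<le> CARD('n) * I_infty x t"
proof -
  let ?D = "(1 + t) * ((\<Sum>i\<in>UNIV. trunc_log c (x $ i)) - CARD('n) * c * ln (1 + t))"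
  have "?D / CARD('n) \<le> I_infty x t"
    unfolding I_infty_def
  proof (rule cInf_greatest)
    show "{(\<Sum>i\<in>UNIV. h $ i * x $ i) / real CARD('n) | h.
     h \<in> nonneg_vecs \<and> norm_infty h \<le> 1 + t \<and> norm_zero h = 1} \<noteq> {}"
      using one_vec_feasible[OF t] by blast
    fix v assume "v \<in> {(\<Sum>i\<in>UNIV. h $ i * x $ i) / real CARD('n) | h.
     h \<in> nonneg_vecs \<and> norm_infty h \<le> 1 + t \<and> norm_zero h = 1}"
    then obtain h :: "real ^ 'n" where v: "v = (\<Sum>i\<in>UNIV. h $ i * x $ i) / real CARD('n)"
      and h0: "\<And>i. 0 \<le> h $ i" and hi: "norm_infty h \<le> 1 + t" and hz: "norm_zero h = 1"
      by (auto simp: nonneg_vecs_def)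
    have hT: "h $ i \<le> 1 + t" for i
      using hi by (simp add: norm_infty_def)
    have prod1: "(\<Prod>i\<in>UNIV. h $ i) = 1"
      using hz by (simp add: norm_zero_def)
    have hpos: "0 < h $ i" for i
    proof -
      have "h $ i \<noteq> 0" using prod1 by (metis UNIV_I finite_UNIV prod_zero_iff zero_neq_one finite)
      then show ?thesis using h0[of i] by simp
    qed
    have hne: "h $ i \<noteq> 0" for i using hpos[of i] by simp
    have "(\<Sum>i\<in>UNIV. ln (h $ i)) = ln (\<Prod>i\<in>UNIV. h $ i)"
      using hne by (intro ln_prod[symmetric]) auto
    then have sumln: "(\<Sum>i\<in>UNIV. ln (h $ i)) = 0" using prod1 by simp
    have pt: "(1 + t) * (trunc_log c (x $ i) - c * ln (1 + t)) \<le> h $ i * x $ i - (1 + t) * c * ln (h $ i)" for i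
    proof -
      have "trunc_log c (x $ i) \<le> h $ i / (1 + t) * x $ i - c * ln (h $ i / (1 + t))"
        using x hpos[of i] hT[of i] t c by (intro trunc_log_le_linear_minus_ln) (auto simp: nonneg_vecs_def)
      also have "ln (h $ i / (1 + t)) = ln (h $ i) - ln (1 + t)"
        using hpos[of i] t by (simp add: ln_div)
      finally have "(1 + t) * (trunc_log c (x $ i) - c * ln (1 + t))
         \<le> (1 + t) * (h $ i / (1 + t) * x $ i - c * ln (h $ i))"
        using t by (intro mult_left_mono) (auto simp: algebra_simps)
      also have "\<dots> = h $ i * x $ i - (1 + t) * c * ln (h $ i)"
        using t by (simp add: field_simps)
      finally show ?thesis .
    qed
    have "?D = (\<Sum>i\<in>UNIV. (1 + t) * (trunc_log c (x $ i) - c * ln (1 + t)))"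
      by (simp add: sum_distrib_left[symmetric] sum_subtractf)
    also have "\<dots> \<le> (\<Sum>i\<in>UNIV. h $ i * x $ i - (1 + t) * c * ln (h $ i))"
      by (intro sum_mono pt)
    also have "\<dots> = (\<Sum>i\<in>UNIV. h $ i * x $ i)"
      using sumln by (simp add: sum_subtractf sum_distrib_left[symmetric])
    finally show "?D / CARD('n) \<le> v" unfolding v by (intro divide_right_mono) auto
  qed
  then show ?thesis by (simp add: field_simps)
qed

text \<open>
  Strong duality: the hypothesis \<open>opt\<close> says that the coordinatewise minimizers
  $h_i = (1+t)\, c / \max(x_i, c)$ of the Lagrangian satisfy the product constraint.
\<close>
lemma I_infty_eq_dual:
  fixes x :: "real ^ 'n" and c t :: real
  assumes x: "x \<in> nonneg_vecs" and c: "0 < c" and t: "0 \<le> t"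
    and opt: "(1 + t) ^ CARD('n) * (\<Prod>i\<in>UNIV. c / max (x $ i) c) = 1"
  shows "CARD('n) * I_infty x t
           = (1 + t) * ((\<Sum>i\<in>UNIV. trunc_log c (x $ i)) - CARD('n) * c * ln (1 + t))"
proof (rule antisym[OF _ I_infty_ge_dual[OF x c t]])
  define h :: "real ^ 'n" where "h = (\<chi> i. (1 + t) * (c / max (x $ i) c))"
  have m: "0 < max (x $ i) c" for i using c by auto
  have hpos: "0 < h $ i" for i using m[of i] c t by (simp add: h_def)
  have hT: "h $ i \<le> 1 + t" for i
  proof -
    have "c / max (x $ i) c \<le> 1" using m[of i] by (simp add: divide_le_eq)
    then show ?thesis using t mult_left_mono[of "c / max (x $ i) c" 1 "1 + t"] by (simp add: h_def)
  qed
  have prod1: "(\<Prod>i\<in>UNIV. h $ i) = 1"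
    using opt by (simp only: h_def vec_lambda_beta prod.distrib prod_constant)
  have hne: "h $ i \<noteq> 0" for i using hpos[of i] by simp
  have "(\<Sum>i\<in>UNIV. ln (h $ i)) = ln (\<Prod>i\<in>UNIV. h $ i)"
    using hne by (intro ln_prod[symmetric]) auto
  then have sumln: "(\<Sum>i\<in>UNIV. ln (h $ i)) = 0" using prod1 by simp
  have "I_infty x t \<le> (\<Sum>i\<in>UNIV. h $ i * x $ i) / CARD('n)"
    unfolding I_infty_def
  proof (rule cInf_lower[OF _ I_infty_bdd_below[OF x]])
    have "h \<in> nonneg_vecs" using hpos by (auto simp: nonneg_vecs_def less_imp_le)
    moreover have "norm_infty h \<le> 1 + t" using hT by (auto simp: norm_infty_def)
    moreover have "norm_zero h = 1" using prod1 by (simp add: norm_zero_def)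
    ultimately show "(\<Sum>i\<in>UNIV. h $ i * x $ i) / CARD('n) \<in> {(\<Sum>i\<in>UNIV. h $ i * x $ i) / real CARD('n) | h.
     h \<in> nonneg_vecs \<and> norm_infty h \<le> 1 + t \<and> norm_zero h = 1}" by blast
  qed
  then have "CARD('n) * I_infty x t \<le> (\<Sum>i\<in>UNIV. h $ i * x $ i)"
    by (simp add: field_simps)
  also have "\<dots> = (\<Sum>i\<in>UNIV. h $ i * x $ i - (1 + t) * c * ln (h $ i))"
    using sumln by (simp add: sum_subtractf sum_distrib_left[symmetric])
  also have "\<dots> = (\<Sum>i\<in>UNIV. (1 + t) * (trunc_log c (x $ i) - c * ln (1 + t)))"
  proof (rule sum.cong[OF refl])
    fix i
    have "ln (h $ i) = ln (1 + t) + ln (c / max (x $ i) c)"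
      unfolding h_def vec_lambda_beta using t c m[of i] by (intro ln_mult_pos) auto
    then show "h $ i * x $ i - (1 + t) * c * ln (h $ i) = (1 + t) * (trunc_log c (x $ i) - c * ln (1 + t))"
      using x c by (subst trunc_log_eq_linear_minus_ln) (auto simp: nonneg_vecs_def h_def algebra_simps)
  qed
  also have "\<dots> = (1 + t) * ((\<Sum>i\<in>UNIV. trunc_log c (x $ i)) - CARD('n) * c * ln (1 + t))"
    by (simp add: sum_distrib_left[symmetric] sum_subtractf)
  finally show "CARD('n) * I_infty x t \<le>
    (1 + t) * ((\<Sum>i\<in>UNIV. trunc_log c (x $ i)) - CARD('n) * c * ln (1 + t))" .
qed

text \<open>
  The product of the minimizers increases continuously with $c$, up to $(1+t)^n \ge 1$ when $c$ exceeds
  all $x_i$. It gets below $1$ only if some $x_j$ is positive, whence \<open>x \<noteq> 0\<close>.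
\<close>
lemma ex_optimal_multiplier_I_infty:
  fixes x :: "real ^ 'n"
  assumes x: "x \<in> nonneg_vecs" and "x \<noteq> 0" and t: "0 \<le> t"
  shows "\<exists>c>0. (1 + t) ^ CARD('n) * (\<Prod>i\<in>UNIV. c / max (x $ i) c) = 1"
proof -
  let ?p = "\<lambda>c. (1 + t) ^ CARD('n) * (\<Prod>i\<in>UNIV. c / max (x $ i) c)"
  obtain j where "x $ j \<noteq> 0" using \<open>x \<noteq> 0\<close> by (metis vec_eq_iff zero_index)
  then have j: "0 < x $ j" using x by (auto simp: nonneg_vecs_def less_le)
  define M where "M = (\<Sum>i\<in>UNIV. x $ i)"
  have M: "x $ i \<le> M" for i
    unfolding M_def using x by (intro member_le_sum) (auto simp: nonneg_vecs_def)
  have Mpos: "0 < M" using M[of j] j by simp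
  define T where "T = (1 + t) ^ CARD('n)"
  have T: "1 \<le> T" using t by (simp add: T_def)
  \<comment> \<open>At this level the factor of \<open>j\<close> alone is $1/T$, while the other factors are at most $1$.\<close>
  define d where "d = x $ j / T"
  have d: "0 < d" "d \<le> x $ j" using j T by (auto simp: d_def divide_le_eq)
  have "(\<Prod>i\<in>UNIV. d / max (x $ i) d) \<le> d / x $ j"
  proof -
    have "(\<Prod>i\<in>UNIV. d / max (x $ i) d) = d / max (x $ j) d * (\<Prod>i\<in>UNIV - {j}. d / max (x $ i) d)"
      by (simp add: prod.remove[of UNIV j])
    also have "\<dots> \<le> d / max (x $ j) d * 1"
      using d by (intro mult_left_mono prod_le_1) (auto simp: divide_le_eq max_def)
    finally show ?thesis using d by (simp add: max_def split: if_splits)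
  qed
  then have lo: "?p d \<le> 1"
    using T j mult_left_mono[of "\<Prod>i\<in>UNIV. d / max (x $ i) d" "d / x $ j" T]
    by (simp add: T_def[symmetric]) (simp add: d_def)
  have "(\<Prod>i\<in>UNIV. M / max (x $ i) M) = (\<Prod>i\<in>(UNIV::'n set). 1)"
    using M Mpos by (intro prod.cong) (auto simp: max_def)
  then have hi: "1 \<le> ?p M" using T by (simp add: T_def)
  have "continuous_on {d..M} ?p"
    using d by (intro continuous_intros) (auto simp: max_def split: if_splits)
  then have "\<exists>c\<ge>d. c \<le> M \<and> ?p c = 1"
    using d M[of j] by (intro IVT' lo hi) auto
  then obtain c where "d \<le> c" "?p c = 1" by blast
  then show ?thesis using d by (intro exI[of _ c]) simp
qed

text \<open>
  Given $c$, there is a $t$ for which $c$ is the optimal multiplier of $y$; weak duality for $x$ at this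
  $t$ then yields the comparison at $c$. Conversely, given $t$, the optimal multiplier of $x$ is used,
  with weak duality for $y$.
\<close>
lemma prec_infty_iff_trunc_log_le:
  fixes x y :: "real ^ 'n"
  assumes x: "x \<in> nonneg_vecs" and y: "y \<in> nonneg_vecs"
  shows "x \<prec>\<^sub>\<infinity> y \<longleftrightarrow> trunc_log_le x y"
proof
  assume le: "x \<prec>\<^sub>\<infinity> y"
  show "trunc_log_le x y" unfolding trunc_log_le_def
  proof (intro allI impI)
    fix c :: real assume c: "0 < c"
    define P where "P = (\<Prod>i\<in>UNIV. c / max (y $ i) c)"
    have P: "0 < P" "P \<le> 1"
      unfolding P_def using c by (auto intro!: prod_pos prod_le_1 simp: max_def divide_le_eq)
    \<comment> \<open>The unique \<open>t\<close> for which $c$ is the optimal multiplier of $y$; it is nonnegative as $P \le 1$.\<close>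
    define t where "t = root CARD('n) (1 / P) - 1"
    have t: "0 \<le> t" using P by (simp add: t_def)
    have "(1 + t) ^ CARD('n) = 1 / P" using P by (simp add: t_def)
    then have opt: "(1 + t) ^ CARD('n) * (\<Prod>i\<in>UNIV. c / max (y $ i) c) = 1"
      unfolding P_def[symmetric] using P by simp
    have "(1 + t) * ((\<Sum>i\<in>UNIV. trunc_log c (x $ i)) - CARD('n) * c * ln (1 + t)) \<le> CARD('n) * I_infty x t"
      by (rule I_infty_ge_dual[OF x c t])
    also have "\<dots> \<le> CARD('n) * I_infty y t"
      using le t by (intro mult_left_mono) (auto simp: prec_infty_def)
    also note I_infty_eq_dual[OF y c t opt]
    finally show "(\<Sum>i\<in>UNIV. trunc_log c (x $ i)) \<le> (\<Sum>i\<in>UNIV. trunc_log c (y $ i))"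
      using t by simp
  qed
next
  assume le: "trunc_log_le x y"
  show "x \<prec>\<^sub>\<infinity> y" unfolding prec_infty_def
  proof (intro allI impI)
    fix t :: real assume t: "0 \<le> t"
    have "CARD('n) * I_infty x t \<le> CARD('n) * I_infty y t"
    proof (cases "x = 0")
      case True
      \<comment> \<open>The zero vector has no optimal multiplier, but its infimum is $0$.\<close>
      have nonneg: "0 \<le> I_infty y t"
        unfolding I_infty_def
        using one_vec_feasible[OF t, where 'n = 'n] y
        by (intro cInf_greatest) (auto simp: nonneg_vecs_def intro!: sum_nonneg divide_nonneg_nonneg)
      have "I_infty x t = 0"
        unfolding I_infty_def True
        using one_vec_feasible[OF t, where 'n = 'n] by (auto intro: cInf_eq_minimum)
      then show ?thesis using nonneg by simp
    next
      case False
      obtain c where c: "0 < c" and opt: "(1 + t) ^ CARD('n) * (\<Prod>i\<in>UNIV. c / max (x $ i) c) = 1"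
        using ex_optimal_multiplier_I_infty[OF x False t] by blast
      note I_infty_eq_dual[OF x c t opt]
      also have "(1 + t) * ((\<Sum>i\<in>UNIV. trunc_log c (x $ i)) - CARD('n) * c * ln (1 + t))
        \<le> (1 + t) * ((\<Sum>i\<in>UNIV. trunc_log c (y $ i)) - CARD('n) * c * ln (1 + t))"
        using le c t by (intro mult_left_mono) (auto simp: trunc_log_le_def)
      also note I_infty_ge_dual[OF y c t]
      finally show ?thesis .
    qed
    then show "I_infty x t \<le> I_infty y t" by simp
  qed
qed

section \<open>Duality for the supremum of products\<close>

text \<open>
  The Lagrangian of one coordinate in the maximization of $\sum_i \log(z_i + t x_i)$, with $z_i = t w$.
  The exponential form is also meaningful when a factor vanishes.
\<close>

lemma add_le_exp_trunc_log:
  assumes c: "0 < c" and "0 \<le> s" "0 \<le> w"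
  shows "w + s \<le> c * exp (trunc_log c s / c - 1 + w / c)"
proof (cases "s \<le> c")
  case True
  have "(w + s) / c \<le> exp ((w + s) / c - 1)"
    using exp_ge_add_one_self[of "(w + s) / c - 1"] by simp
  then have "w + s \<le> c * exp ((w + s) / c - 1)" using c by (simp add: field_simps)
  also have "(w + s) / c - 1 = trunc_log c s / c - 1 + w / c"
    using True c by (simp add: trunc_log_def field_simps)
  finally show ?thesis .
next
  case False
  have "w + s \<le> s * (1 + w / c)"
    using False assms mult_right_mono[of c s w] by (simp add: field_simps)
  also have "\<dots> \<le> s * exp (w / c)"
    using assms exp_ge_add_one_self[of "w / c"] by (intro mult_left_mono) auto
  also have "\<dots> = c * exp (trunc_log c s / c - 1 + w / c)"
  proof -
    have "trunc_log c s / c - 1 + w / c = ln (s / c) + w / c"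
      using False c by (simp add: trunc_log_def field_simps)
    then show ?thesis using False c by (simp add: exp_add)
  qed
  finally show ?thesis .
qed

text \<open>
  Equality in the preceding estimate at the water-filling choice $w = \max(c - s, 0)$, for which
  $w + s = \max(s, c)$.
\<close>
lemma max_eq_exp_trunc_log:
  assumes c: "0 < c" and "0 \<le> s"
  shows "max s c = c * exp (trunc_log c s / c - 1 + max (c - s) 0 / c)"
proof (cases "s \<le> c")
  case True
  then have "trunc_log c s / c - 1 + max (c - s) 0 / c = 0"
    using c by (simp add: trunc_log_def field_simps)
  then show ?thesis using True by simp
next
  case False
  then have "trunc_log c s / c - 1 + max (c - s) 0 / c = ln (s / c)"
    using c by (simp add: trunc_log_def field_simps)
  then show ?thesis using False c by (simp add: exp_ln)
qed

lemma prod_scaled_exp: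
  fixes f :: "'n::finite \<Rightarrow> real"
  shows "(\<Prod>i\<in>UNIV. a * exp (f i)) = a ^ CARD('n) * exp (\<Sum>i\<in>UNIV. f i)"
  by (simp add: prod.distrib exp_sum)

text \<open>
  Weak duality: the factors $z_i$ occur in the product of the coordinatewise bounds only through
  their sum, which is fixed.
\<close>
lemma sup_prod_le_dual:
  fixes x :: "real ^ 'n" and c t :: real
  assumes x: "x \<in> nonneg_vecs" and c: "0 < c" and t: "0 < t"
  shows "sup_prod x t \<le> (t * c) ^ CARD('n) *
           exp ((\<Sum>i\<in>UNIV. trunc_log c (x $ i)) / c - CARD('n) + CARD('n) / (t * c))"
  unfolding sup_prod_def
proof (rule cSUP_least)
  show "{z :: real ^ 'n. z \<in> nonneg_vecs \<and> norm_one z = 1} \<noteq> {}"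
    using one_vec_feasible[of 0] by force
  fix z :: "real ^ 'n" assume "z \<in> {z. z \<in> nonneg_vecs \<and> norm_one z = 1}"
  then have z0: "\<And>i. 0 \<le> z $ i" and zs: "(\<Sum>i\<in>UNIV. z $ i) = CARD('n)"
    by (auto simp: nonneg_vecs_def norm_one_def)
  have "z $ i + t * x $ i \<le> (t * c) * exp (trunc_log c (x $ i) / c - 1 + z $ i / (t * c))" for i
  proof -
    have "z $ i / t + x $ i \<le> c * exp (trunc_log c (x $ i) / c - 1 + z $ i / t / c)"
      using x z0 t c by (intro add_le_exp_trunc_log) (auto simp: nonneg_vecs_def)
    then have "t * (z $ i / t + x $ i) \<le> t * (c * exp (trunc_log c (x $ i) / c - 1 + z $ i / t / c))"
      using t by (intro mult_left_mono) auto
    moreover have "t * (z $ i / t + x $ i) = z $ i + t * x $ i"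
      using t by (simp add: distrib_left)
    ultimately show ?thesis by (simp add: mult.assoc)
  qed
  then have "(\<Prod>i\<in>UNIV. z $ i + t * x $ i)
      \<le> (\<Prod>i\<in>UNIV. (t * c) * exp (trunc_log c (x $ i) / c - 1 + z $ i / (t * c)))"
    using x z0 t by (intro prod_mono) (auto simp: nonneg_vecs_def)
  also have "\<dots> = (t * c) ^ CARD('n) * exp (\<Sum>i\<in>UNIV. trunc_log c (x $ i) / c - 1 + z $ i / (t * c))"
    by (rule prod_scaled_exp)
  also have "(\<Sum>i\<in>UNIV. trunc_log c (x $ i) / c - 1 + z $ i / (t * c))
      = (\<Sum>i\<in>UNIV. trunc_log c (x $ i)) / c - CARD('n) + CARD('n) / (t * c)"
    by (simp add: sum.distrib sum_subtractf sum_divide_distrib[symmetric] zs)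
  finally show "(\<Prod>i\<in>UNIV. z $ i + t * x $ i) \<le> (t * c) ^ CARD('n) *
           exp ((\<Sum>i\<in>UNIV. trunc_log c (x $ i)) / c - CARD('n) + CARD('n) / (t * c))" .
qed

lemma sup_prod_ge:
  fixes x z :: "real ^ 'n"
  assumes "x \<in> nonneg_vecs" "0 \<le> t" "z \<in> nonneg_vecs" "norm_one z = 1"
  shows "(\<Prod>i\<in>UNIV. z $ i + t * x $ i) \<le> sup_prod x t"
  unfolding sup_prod_def
  using assms by (intro cSUP_upper sup_prod_bdd_above) auto

text \<open>
  Strong duality: by the hypothesis \<open>opt\<close>, the water-filling vector
  $z_i = t \max(c - x_i, 0)$ has the prescribed mean.
\<close>
lemma sup_prod_ge_dual:
  fixes x :: "real ^ 'n" and c t :: real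
  assumes x: "x \<in> nonneg_vecs" and c: "0 < c" and t: "0 < t"
    and opt: "t * (\<Sum>i\<in>UNIV. max (c - x $ i) 0) = CARD('n)"
  shows "(t * c) ^ CARD('n) *
           exp ((\<Sum>i\<in>UNIV. trunc_log c (x $ i)) / c - CARD('n) + CARD('n) / (t * c))
         \<le> sup_prod x t"
proof -
  define z :: "real ^ 'n" where "z = (\<chi> i. t * max (c - x $ i) 0)"
  have z: "z \<in> nonneg_vecs" using t by (auto simp: z_def nonneg_vecs_def)
  have "norm_one z = 1" using opt by (simp add: norm_one_def z_def sum_distrib_left[symmetric])
  have "CARD('n) / (t * c) = (\<Sum>i\<in>UNIV. max (c - x $ i) 0) / c"
    using t c unfolding opt[symmetric] by simp
  then have "(\<Sum>i\<in>UNIV. trunc_log c (x $ i)) / c - CARD('n) + CARD('n) / (t * c)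
      = (\<Sum>i\<in>UNIV. trunc_log c (x $ i) / c - 1 + max (c - x $ i) 0 / c)"
    by (simp add: sum.distrib sum_subtractf sum_divide_distrib)
  then have "(t * c) ^ CARD('n) *
           exp ((\<Sum>i\<in>UNIV. trunc_log c (x $ i)) / c - CARD('n) + CARD('n) / (t * c))
      = (\<Prod>i\<in>UNIV. (t * c) * exp (trunc_log c (x $ i) / c - 1 + max (c - x $ i) 0 / c))"
    by (simp only: prod_scaled_exp)
  also have "\<dots> = (\<Prod>i\<in>UNIV. z $ i + t * x $ i)"
  proof (rule prod.cong[OF refl])
    fix i
    have "(t * c) * exp (trunc_log c (x $ i) / c - 1 + max (c - x $ i) 0 / c) = t * max (x $ i) c"
      using x c by (subst max_eq_exp_trunc_log[of c]) (auto simp: nonneg_vecs_def)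
    also have "\<dots> = z $ i + t * x $ i"
      by (simp add: z_def max_def algebra_simps)
    finally show "(t * c) * exp (trunc_log c (x $ i) / c - 1 + max (c - x $ i) 0 / c) = z $ i + t * x $ i" .
  qed
  also have "\<dots> \<le> sup_prod x t"
    using t by (intro sup_prod_ge x z \<open>norm_one z = 1\<close>) auto
  finally show ?thesis .
qed

lemma ex_water_level:
  fixes x :: "real ^ 'n"
  assumes x: "x \<in> nonneg_vecs" and t: "0 < t"
  shows "\<exists>c>0. t * (\<Sum>i\<in>UNIV. max (c - x $ i) 0) = CARD('n)"
proof -
  let ?f = "\<lambda>c. t * (\<Sum>i\<in>UNIV. max (c - x $ i) 0)"
  define M where "M = (\<Sum>i\<in>UNIV. x $ i) + 1 / t"
  have x0: "0 \<le> x $ i" for i using x by (simp add: nonneg_vecs_def)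
  have M: "x $ i + 1 / t \<le> M" for i
    unfolding M_def using x0 by (intro add_right_mono member_le_sum) auto
  have "(\<Sum>i\<in>(UNIV::'n set). 1 / t) \<le> (\<Sum>i\<in>UNIV. max (M - x $ i) 0)"
    using M by (intro sum_mono) (smt (verit))
  then have hi: "CARD('n) \<le> ?f M" using t by (simp add: field_simps)
  have f0: "?f 0 = 0" using x0 by (simp add: max_def)
  have "0 \<le> M" using M[of undefined] x0[of undefined] t by (smt (verit) divide_pos_pos)
  then have "\<exists>c\<ge>0. c \<le> M \<and> ?f c = CARD('n)"
    using f0 hi by (intro IVT') (auto intro!: continuous_intros)
  then obtain c where c: "0 \<le> c" "?f c = CARD('n)" by blast
  then have "c \<noteq> 0" using f0 by auto
  then show ?thesis using c by (intro exI[of _ c]) simp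
qed

text \<open>
  Given $t$, the water level $c$ of $y$ compares the dual bounds. Conversely, given $c$ above the smallest
  $x_j$, some $t$ makes $c$ the water level of $x$. If $c \le x_i$ for all $i$, no amount of water
  does so; then the product at $z = (1, \dots, 1)$ is already at least the dual value of $x$ without the
  summand $n/(tc)$ in its exponent, an error that disappears as $t \to \infty$.
\<close>
lemma sup_prod_le_iff_trunc_log_le:
  fixes x y :: "real ^ 'n"
  assumes x: "x \<in> nonneg_vecs" and y: "y \<in> nonneg_vecs"
  shows "(\<forall>t>0. sup_prod x t \<le> sup_prod y t) \<longleftrightarrow> trunc_log_le x y"
proof
  assume le: "trunc_log_le x y"
  show "\<forall>t>0. sup_prod x t \<le> sup_prod y t"
  proof (intro allI impI)
    fix t :: real assume t: "0 < t"
    obtain c where c: "0 < c" and opt: "t * (\<Sum>i\<in>UNIV. max (c - y $ i) 0) = CARD('n)"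
      using ex_water_level[OF y t] by blast
    note sup_prod_le_dual[OF x c t]
    also have "(t * c) ^ CARD('n) *
           exp ((\<Sum>i\<in>UNIV. trunc_log c (x $ i)) / c - CARD('n) + CARD('n) / (t * c))
       \<le> (t * c) ^ CARD('n) *
           exp ((\<Sum>i\<in>UNIV. trunc_log c (y $ i)) / c - CARD('n) + CARD('n) / (t * c))"
      using le t c by (intro mult_left_mono) (auto simp: trunc_log_le_def divide_right_mono)
    also note sup_prod_ge_dual[OF y c t opt]
    finally show "sup_prod x t \<le> sup_prod y t" .
  qed
next
  assume le: "\<forall>t>0. sup_prod x t \<le> sup_prod y t"
  show "trunc_log_le x y" unfolding trunc_log_le_def
  proof (intro allI impI)
    fix c :: real assume c: "0 < c"
    let ?X = "\<Sum>i\<in>UNIV. trunc_log c (x $ i)" and ?Y = "\<Sum>i\<in>UNIV. trunc_log c (y $ i)"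
    show "?X \<le> ?Y"
    proof (cases "\<exists>j. x $ j < c")
      case True
      then obtain j where "x $ j < c" ..
      then have "0 < (\<Sum>i\<in>UNIV. max (c - x $ i) 0)"
        by (intro sum_pos2[where i = j]) auto
      define t where "t = CARD('n) / (\<Sum>i\<in>UNIV. max (c - x $ i) 0)"
      have t: "0 < t" and opt: "t * (\<Sum>i\<in>UNIV. max (c - x $ i) 0) = CARD('n)"
        using \<open>0 < (\<Sum>i\<in>UNIV. max (c - x $ i) 0)\<close> by (auto simp: t_def)
      note sup_prod_ge_dual[OF x c t opt]
      also have "sup_prod x t \<le> sup_prod y t" using le t by blast
      also note sup_prod_le_dual[OF y c t]
      finally show ?thesis using t c by (simp add: divide_le_cancel)
    next
      case False
      have bound: "?X \<le> ?Y + CARD('n) / t" if t: "0 < t" for t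
      proof -
        have "(t * c) ^ CARD('n) * exp (?X / c - CARD('n))
            = (\<Prod>i\<in>UNIV. (t * c) * exp (trunc_log c (x $ i) / c - 1))"
          unfolding prod_scaled_exp by (simp add: sum_subtractf sum_divide_distrib)
        also have "\<dots> = (\<Prod>i\<in>UNIV. t * x $ i)"
        proof (rule prod.cong[OF refl])
          fix i
          have "c \<le> x $ i" using False by (simp add: not_less)
          then show "(t * c) * exp (trunc_log c (x $ i) / c - 1) = t * x $ i"
            using max_eq_exp_trunc_log[of c "x $ i"] c by simp
        qed
        also have "\<dots> \<le> (\<Prod>i\<in>UNIV. (1 :: real ^ 'n) $ i + t * x $ i)"
          using x t by (intro prod_mono) (auto simp: nonneg_vecs_def)
        also have "\<dots> \<le> sup_prod x t"
          using t x one_vec_feasible[of 0, where 'n = 'n] by (intro sup_prod_ge) auto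
        also have "\<dots> \<le> sup_prod y t" using le t by blast
        also note sup_prod_le_dual[OF y c t]
        finally have "?X / c \<le> ?Y / c + CARD('n) / (t * c)" using t c by simp
        then show ?thesis using t c by (simp add: field_simps)
      qed
      show ?thesis
      proof (rule field_le_epsilon)
        fix e :: real assume e: "0 < e"
        then show "?X \<le> ?Y + e" using bound[of "CARD('n) / e"] by simp
      qed
    qed
  qed
qed


section \<open>Truncated logarithms as logarithmic primitives\<close>

lemma trunc_log_0: "0 \<le> s \<Longrightarrow> trunc_log 0 s = 0"
  by (simp add: trunc_log_def)

lemma integral_min_over_id:
  assumes c: "0 \<le> c" and s: "0 \<le> s"
  shows "set_integrable lborel {0<..s} (\<lambda>t. min t c / t)"
    and "(LBINT t:{0<..s}. min t c / t) = trunc_log c s"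
proof -
  let ?f = "\<lambda>t::real. min t c / t"
  \<comment> \<open>The closed form is an antiderivative away from the corner at $c$.\<close>
  have "(?f has_integral trunc_log c s) {0<..s}"
  proof (cases "c = 0")
    case True
    then show ?thesis using s by (auto simp: trunc_log_0 intro!: has_integral_is_0)
  next
    case False
    then have c: "0 < c" using c by simp
    have der: "(trunc_log c has_vector_derivative ?f t) (at t)" if t: "t \<in> {0<..<s} - {c}" for t
    proof (cases "t < c")
      case True
      have "((\<lambda>u. u) has_vector_derivative ?f t) (at t)"
        using t True by (auto intro!: derivative_eq_intros)
      then show ?thesis
        by (rule has_vector_derivative_transform_within_open[of _ _ _ "{0<..<c}"])
           (use t True c in \<open>auto simp: trunc_log_def\<close>)
    next
      case False
      then have tc: "c < t" using t by auto
      have "((\<lambda>u. c + c * ln (u / c)) has_real_derivative ?f t) (at t)"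
        using t tc c by (auto intro!: derivative_eq_intros)
      then have "((\<lambda>u. c + c * ln (u / c)) has_vector_derivative ?f t) (at t)"
        by (simp add: has_real_derivative_iff_has_vector_derivative)
      then show ?thesis
        by (rule has_vector_derivative_transform_within_open[of _ _ _ "{c<..}"])
           (use tc in \<open>auto simp: trunc_log_def\<close>)
    qed
    have "continuous_on {0..s} (trunc_log c)"
      unfolding trunc_log_def[abs_def] using c
      by (intro continuous_intros) (auto simp: max_def split: if_splits)
    then have "(?f has_integral (trunc_log c s - trunc_log c 0)) {0..s}"
      using s der by (intro fundamental_theorem_of_calculus_interior_strong[of "{c}"]) auto
    moreover have "trunc_log c 0 = 0" using c by (simp add: trunc_log_def)
    ultimately have "(?f has_integral trunc_log c s) {0..s}" by simp
    \<comment> \<open>The added endpoint is harmless: division by zero makes the integrand vanish there.\<close>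
    moreover have no_new: "{t \<in> {0..s} - {0<..s}. ?f t \<noteq> 0} = {}" "{t \<in> {0<..s} - {0..s}. ?f t \<noteq> 0} = {}"
      by auto
    ultimately show ?thesis
      using has_integral_spike_set_eq[of "{0..s}" "{0<..s}" ?f "trunc_log c s", unfolded no_new] by simp
  qed
  note hi = this
  have "?f absolutely_integrable_on {0<..s}"
    using hi c by (intro nonnegative_absolutely_integrable_1) auto
  then show int: "set_integrable lborel {0<..s} ?f"
    unfolding set_integrable_def by (subst (asm) integrable_completion) auto
  show "(LBINT t:{0<..s}. ?f t) = trunc_log c s"
    using set_borel_integral_eq_integral(2)[OF int] hi by (simp add: integral_unique)
qed

lemma log_primitive_trunc_log:
  assumes c: "0 < c"
  shows "log_primitive (trunc_log c)"
  unfolding log_primitive_def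
proof (intro exI[of _ "\<lambda>t. min t c"] conjI)
  show "concave_on {0..} (\<lambda>t. min t c)"
    unfolding concave_on_iff
  proof (intro conjI ballI allI impI)
    fix x y u v :: real assume uv: "0 \<le> u" "0 \<le> v" "u + v = 1"
    have "u * min x c \<le> u * x" "u * min x c \<le> u * c" "v * min y c \<le> v * y" "v * min y c \<le> v * c"
      using uv by (auto intro!: mult_left_mono)
    moreover have "u * c + v * c = c" using uv by (simp flip: distrib_right)
    ultimately show "u * min x c + v * min y c \<le> min (u *\<^sub>R x + v *\<^sub>R y) c" by auto
  qed auto
qed (use c integral_min_over_id[of c] in \<open>auto simp: mono_on_def\<close>)

section \<open>Piecewise linear interpolation of concave functions\<close>

text \<open>
  If \<open>\<phi> 0 = 0\<close>, this is the interpolant of \<open>\<phi>\<close> at the nodes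
  $0, \delta, \dots, m\delta$, continued by a constant after the last one. The sum runs over the increments of the cells, so that both the
  values at the nodes and the coefficients of the functions $\min(\cdot, k\delta)$ can be read off.
\<close>

definition interpolant :: "(real \<Rightarrow> real) \<Rightarrow> real \<Rightarrow> nat \<Rightarrow> real \<Rightarrow> real" where
  "interpolant \<phi> \<delta> m t = (\<Sum>k<m. (\<phi> (real (Suc k) * \<delta>) - \<phi> (real k * \<delta>)) / \<delta> * (min t (real (Suc k) * \<delta>) - min t (real k * \<delta>)))"

lemma interpolant_beyond_last_node:
  assumes "0 < \<delta>" "\<phi> 0 = 0" "real m * \<delta> \<le> t"
  shows "interpolant \<phi> \<delta> m t = \<phi> (real m * \<delta>)"
  using assms(3)
proof (induction m)
  case 0
  then show ?case using assms by (simp add: interpolant_def)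
next
  case (Suc m)
  have "real m * \<delta> \<le> real (Suc m) * \<delta>" using assms by (simp add: algebra_simps)
  then have "real m * \<delta> \<le> t" using Suc.prems by linarith
  have "interpolant \<phi> \<delta> (Suc m) t = interpolant \<phi> \<delta> m t
      + (\<phi> (real (Suc m) * \<delta>) - \<phi> (real m * \<delta>)) / \<delta> * (min t (real (Suc m) * \<delta>) - min t (real m * \<delta>))"
    by (simp add: interpolant_def)
  also have "min t (real (Suc m) * \<delta>) - min t (real m * \<delta>) = \<delta>"
    using Suc.prems \<open>real m * \<delta> \<le> t\<close> by (simp add: min_absorb2 algebra_simps)
  finally show ?case using Suc.IH[OF \<open>real m * \<delta> \<le> t\<close>] assms by simp
qed

lemma interpolant_ignores_later_nodes:
  assumes "0 < \<delta>" "t \<le> real l * \<delta>" "l \<le> m"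
  shows "interpolant \<phi> \<delta> m t = interpolant \<phi> \<delta> l t"
  using assms(3)
proof (induction m rule: dec_induct)
  case base
  show ?case ..
next
  case (step m)
  have "real l * \<delta> \<le> real m * \<delta>" "real m * \<delta> \<le> real (Suc m) * \<delta>"
    using step assms by (auto intro!: mult_right_mono)
  then have "min t (real (Suc m) * \<delta>) = t" "min t (real m * \<delta>) = t" using assms by linarith+
  then show ?case using step by (simp add: interpolant_def)
qed

lemma interpolant_on_cell:
  assumes "0 < \<delta>" "\<phi> 0 = 0" "j < m" "real j * \<delta> \<le> t" "t \<le> real (Suc j) * \<delta>"
  shows "interpolant \<phi> \<delta> m t = \<phi> (real j * \<delta>) + (\<phi> (real (Suc j) * \<delta>) - \<phi> (real j * \<delta>)) * (t / \<delta> - j)"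
proof -
  have "interpolant \<phi> \<delta> m t = interpolant \<phi> \<delta> (Suc j) t"
    using assms by (intro interpolant_ignores_later_nodes) auto
  also have "\<dots> = interpolant \<phi> \<delta> j t
      + (\<phi> (real (Suc j) * \<delta>) - \<phi> (real j * \<delta>)) / \<delta> * (min t (real (Suc j) * \<delta>) - min t (real j * \<delta>))"
    by (simp add: interpolant_def)
  also have "min t (real (Suc j) * \<delta>) - min t (real j * \<delta>) = t - real j * \<delta>" using assms by linarith
  also have "interpolant \<phi> \<delta> j t = \<phi> (real j * \<delta>)"
    using assms by (intro interpolant_beyond_last_node) auto
  finally show ?thesis using assms by (simp add: field_simps)
qed

text \<open>
  The chord lies below a concave function; and by monotonicity the interpolant is at least the value
  of \<open>\<phi>\<close> at the left end of the cell, which is at most \<open>\<delta>\<close> away.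
\<close>
lemma interpolant_bounds:
  assumes mono: "mono_on {0..} \<phi>" and conc: "concave_on {0..} \<phi>" and "\<phi> 0 = 0"
    and \<delta>: "0 < \<delta>" and t: "0 \<le> t" "t < real m * \<delta>"
  shows "interpolant \<phi> \<delta> m t \<le> \<phi> t" and "\<phi> (max 0 (t - \<delta>)) \<le> interpolant \<phi> \<delta> m t"
proof -
  define j where "j = nat \<lfloor>t / \<delta>\<rfloor>"
  have rj: "real j = of_int \<lfloor>t / \<delta>\<rfloor>" using t \<delta> by (simp add: j_def)
  have j: "j \<le> t / \<delta>" "t / \<delta> \<le> Suc j" unfolding of_nat_Suc rj by linarith+
  then have cell: "real j * \<delta> \<le> t" "t \<le> real (Suc j) * \<delta>" using \<delta> by (auto simp: field_simps)
  have "real j * \<delta> < real m * \<delta>" using cell t by linarith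
  then have "j < m" using \<delta> by simp
  note eq = interpolant_on_cell[where \<phi> = \<phi>, OF \<delta> \<open>\<phi> 0 = 0\<close> \<open>j < m\<close> cell]
  have "(1 - (t / \<delta> - j)) * \<phi> (real j * \<delta>) + (t / \<delta> - j) * \<phi> (real (Suc j) * \<delta>)
      \<le> \<phi> ((1 - (t / \<delta> - j)) *\<^sub>R (real j * \<delta>) + (t / \<delta> - j) *\<^sub>R (real (Suc j) * \<delta>))"
    using j \<delta> by (intro concave_onD[OF conc]) auto
  also have "(1 - (t / \<delta> - j)) *\<^sub>R (real j * \<delta>) + (t / \<delta> - j) *\<^sub>R (real (Suc j) * \<delta>) = t"
    using \<delta> by (simp add: field_simps)
  finally show "interpolant \<phi> \<delta> m t \<le> \<phi> t" unfolding eq by (simp add: algebra_simps)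
  have "\<phi> (real j * \<delta>) \<le> \<phi> (real (Suc j) * \<delta>)"
    using \<delta> by (intro mono_onD[OF mono]) auto
  then have "0 \<le> (\<phi> (real (Suc j) * \<delta>) - \<phi> (real j * \<delta>)) * (t / \<delta> - j)"
    using j by (intro mult_nonneg_nonneg) auto
  moreover have "\<phi> (max 0 (t - \<delta>)) \<le> \<phi> (real j * \<delta>)"
    using \<delta> cell by (intro mono_onD[OF mono]) (auto simp: algebra_simps)
  ultimately show "\<phi> (max 0 (t - \<delta>)) \<le> interpolant \<phi> \<delta> m t" unfolding eq by linarith
qed

text \<open>
  Abel summation in the form of an inequality: the remaining terms
  $(d_k - d_{k+1})\, \Phi_{k+1}$ are nonnegative.
\<close>
lemma sum_decreasing_mult_diff_ge:
  fixes d \<Phi> :: "nat \<Rightarrow> real"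
  assumes dec: "\<And>k. d (Suc k) \<le> d k" and \<Phi>: "\<And>k. 0 \<le> \<Phi> k" "\<Phi> 0 = 0"
  shows "d m * \<Phi> (Suc m) \<le> (\<Sum>k<Suc m. d k * (\<Phi> (Suc k) - \<Phi> k))"
proof (induction m)
  case 0
  then show ?case using \<Phi> by simp
next
  case (Suc m)
  have "d (Suc m) * \<Phi> (Suc m) \<le> d m * \<Phi> (Suc m)"
    using dec \<Phi> by (intro mult_right_mono) auto
  then show ?case using Suc by (simp add: algebra_simps)
qed

lemma integral_interpolant:
  assumes "0 \<le> \<delta>" "0 \<le> s"
  shows "set_integrable lborel {0<..s} (\<lambda>t. interpolant \<phi> \<delta> m t / t)" (is ?int)
    and "(LBINT t:{0<..s}. interpolant \<phi> \<delta> m t / t)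
      = (\<Sum>k<m. (\<phi> (real (Suc k) * \<delta>) - \<phi> (real k * \<delta>)) / \<delta> * (trunc_log (real (Suc k) * \<delta>) s - trunc_log (real k * \<delta>) s))" (is ?eq)
proof -
  let ?d = "\<lambda>k::nat. (\<phi> (real (Suc k) * \<delta>) - \<phi> (real k * \<delta>)) / \<delta>"
  have eq: "(\<lambda>t. interpolant \<phi> \<delta> m t / t)
      = (\<lambda>t. \<Sum>k<m. ?d k * (min t (real (Suc k) * \<delta>) / t - min t (real k * \<delta>) / t))"
    by (simp add: interpolant_def sum_divide_distrib diff_divide_distrib right_diff_distrib)
  have int: "set_integrable lborel {0<..s} (\<lambda>t. min t (real k * \<delta>) / t)" for k :: nat
    using assms by (intro integral_min_over_id) auto
  have int2: "set_integrable lborel {0<..s} (\<lambda>t. ?d k * (min t (real (Suc k) * \<delta>) / t - min t (real k * \<delta>) / t))" for k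
    by (intro set_integrable_mult_right set_integral_diff int)
  show ?int unfolding eq set_integrable_def scaleR_sum_right
    by (intro Bochner_Integration.integrable_sum int2[unfolded set_integrable_def])
  have "(LBINT t:{0<..s}. interpolant \<phi> \<delta> m t / t)
      = (\<Sum>k<m. LBINT t:{0<..s}. ?d k * (min t (real (Suc k) * \<delta>) / t - min t (real k * \<delta>) / t))"
    unfolding eq set_lebesgue_integral_def scaleR_sum_right
    by (intro Bochner_Integration.integral_sum int2[unfolded set_integrable_def])
  also have "\<dots> = (\<Sum>k<m. ?d k * (trunc_log (real (Suc k) * \<delta>) s - trunc_log (real k * \<delta>) s))"
    using assms by (intro sum.cong refl) (simp only: set_integral_mult_right set_integral_diff(2)[OF int int]
      integral_min_over_id(2) mult_nonneg_nonneg of_nat_0_le_iff)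
  finally show ?eq .
qed

text \<open>
  The comparison for interpolants. The slopes of a concave function decrease, so the difference of the two
  sides is a sum to which \<open>sum_decreasing_mult_diff_ge\<close> applies, with $\Phi_k$ the
  difference of the sums of truncated logarithms at level $k\delta$.
\<close>
lemma sum_integral_interpolant_mono:
  fixes x y :: "real ^ 'n"
  assumes x: "x \<in> nonneg_vecs" and y: "y \<in> nonneg_vecs" and le: "trunc_log_le x y"
    and mono: "mono_on {0..} \<phi>" and conc: "concave_on {0..} \<phi>" and \<delta>: "0 < \<delta>"
  shows "(\<Sum>i\<in>UNIV. LBINT t:{0<..x $ i}. interpolant \<phi> \<delta> (Suc m) t / t)
       \<le> (\<Sum>i\<in>UNIV. LBINT t:{0<..y $ i}. interpolant \<phi> \<delta> (Suc m) t / t)"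
proof -
  define d where "d k = (\<phi> (real (Suc k) * \<delta>) - \<phi> (real k * \<delta>)) / \<delta>" for k :: nat
  define \<Phi> where "\<Phi> k = (\<Sum>i\<in>UNIV. trunc_log (real k * \<delta>) (y $ i)) - (\<Sum>i\<in>UNIV. trunc_log (real k * \<delta>) (x $ i))" for k :: nat
  have dec: "d (Suc k) \<le> d k" for k
  proof -
    have "(1 - 1/2) * \<phi> (real k * \<delta>) + 1/2 * \<phi> (real (Suc (Suc k)) * \<delta>)
        \<le> \<phi> ((1 - 1/2) *\<^sub>R (real k * \<delta>) + (1/2) *\<^sub>R (real (Suc (Suc k)) * \<delta>))"
      using \<delta> by (intro concave_onD[OF conc]) auto
    also have "(1 - 1/2) *\<^sub>R (real k * \<delta>) + (1/2) *\<^sub>R (real (Suc (Suc k)) * \<delta>) = real (Suc k) * \<delta>"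
      by (simp add: field_simps)
    finally show ?thesis unfolding d_def using \<delta> by (intro divide_right_mono) auto
  qed
  have d0: "0 \<le> d k" for k
    unfolding d_def using \<delta> by (auto intro!: divide_nonneg_pos mono_onD[OF mono])
  have \<Phi>0: "\<Phi> 0 = 0"
    using x y by (simp add: \<Phi>_def trunc_log_0 nonneg_vecs_def)
  have \<Phi>: "0 \<le> \<Phi> k" for k
    using \<Phi>0 le \<delta> by (cases "k = 0") (auto simp: \<Phi>_def trunc_log_le_def)
  have sum: "(\<Sum>i\<in>UNIV. LBINT t:{0<..z $ i}. interpolant \<phi> \<delta> (Suc m) t / t)
      = (\<Sum>k<Suc m. d k * ((\<Sum>i\<in>UNIV. trunc_log (real (Suc k) * \<delta>) (z $ i)) - (\<Sum>i\<in>UNIV. trunc_log (real k * \<delta>) (z $ i))))"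
    if "z \<in> nonneg_vecs" for z :: "real ^ 'n"
  proof -
    have "(\<Sum>i\<in>UNIV. LBINT t:{0<..z $ i}. interpolant \<phi> \<delta> (Suc m) t / t)
      = (\<Sum>i\<in>UNIV. \<Sum>k<Suc m. d k * (trunc_log (real (Suc k) * \<delta>) (z $ i) - trunc_log (real k * \<delta>) (z $ i)))"
      using that \<delta> by (intro sum.cong refl) (subst integral_interpolant(2), auto simp: d_def nonneg_vecs_def)
    also have "\<dots> = (\<Sum>k<Suc m. \<Sum>i\<in>UNIV. d k * (trunc_log (real (Suc k) * \<delta>) (z $ i) - trunc_log (real k * \<delta>) (z $ i)))"
      by (rule sum.swap)
    finally show ?thesis by (simp only: sum_distrib_left[symmetric] sum_subtractf)
  qed
  have "0 \<le> d m * \<Phi> (Suc m)" using d0 \<Phi> by simp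
  also have "\<dots> \<le> (\<Sum>k<Suc m. d k * (\<Phi> (Suc k) - \<Phi> k))"
    by (rule sum_decreasing_mult_diff_ge[of d \<Phi> m, OF dec \<Phi> \<Phi>0])
  also have "\<dots> = (\<Sum>i\<in>UNIV. LBINT t:{0<..y $ i}. interpolant \<phi> \<delta> (Suc m) t / t)
       - (\<Sum>i\<in>UNIV. LBINT t:{0<..x $ i}. interpolant \<phi> \<delta> (Suc m) t / t)"
    unfolding sum[OF x] sum[OF y] \<Phi>_def
    by (subst sum_subtractf[symmetric], intro sum.cong refl) (simp only: algebra_simps)
  finally show ?thesis by simp
qed

text \<open>
  The value at $0$ does not affect the logarithmic primitive, so it may be lowered to $0$; this keeps the
  function concave and lets its interpolants start at $0$.
\<close>
lemma concave_on_replace_at_0: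
  fixes \<phi> :: "real \<Rightarrow> real"
  assumes conc: "concave_on {0..} \<phi>" and pos: "\<And>t. 0 \<le> t \<Longrightarrow> 0 \<le> \<phi> t"
  shows "concave_on {0..} (\<phi>(0 := 0))"
  unfolding concave_on_iff
proof (intro conjI ballI allI impI)
  fix x y u v :: real
  assume xy: "x \<in> {0..}" "y \<in> {0..}" and uv: "0 \<le> u" "0 \<le> v" "u + v = 1"
  let ?p = "\<phi>(0 := 0)"
  show "u * ?p x + v * ?p y \<le> ?p (u *\<^sub>R x + v *\<^sub>R y)"
  proof (cases "u * x + v * y = 0")
    case True
    then have "u * x = 0" "v * y = 0" using xy uv by (simp_all add: add_nonneg_eq_0_iff)
    then show ?thesis using True by auto
  next
    case False
    have "u * ?p x + v * ?p y \<le> u * \<phi> x + v * \<phi> y"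
      using xy uv pos by (intro add_mono mult_left_mono) auto
    also have "\<dots> \<le> \<phi> (u *\<^sub>R x + v *\<^sub>R y)"
      using conc xy uv unfolding concave_on_iff by blast
    finally show ?thesis using False by simp
  qed
qed auto

section \<open>Passage to general logarithmic primitives\<close>

text \<open>
  Dominated convergence with majorant \<open>\<phi> t / t\<close>. The pointwise limit uses that a
  concave function is continuous in the interior of its domain.
\<close>
lemma integral_interpolant_tendsto:
  assumes mono: "mono_on {0..} \<phi>" and conc: "concave_on {0..} \<phi>" and \<phi>0: "\<phi> 0 = 0"
    and int: "set_integrable lborel {0<..s} (\<lambda>t. \<phi> t / t)" and s: "0 \<le> s" "s < M"
  shows "(\<lambda>m. LBINT t:{0<..s}. interpolant \<phi> (M / Suc m) (Suc m) t / t)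
           \<longlonglongrightarrow> (LBINT t:{0<..s}. \<phi> t / t)"
proof -
  have pos: "0 \<le> \<phi> t" if "0 \<le> t" for t
    using mono_onD[OF mono, of 0 t] that \<phi>0 by simp
  have bounds: "interpolant \<phi> (M / Suc m) (Suc m) t \<le> \<phi> t"
    "\<phi> (max 0 (t - M / Suc m)) \<le> interpolant \<phi> (M / Suc m) (Suc m) t" if "t \<in> {0<..s}" for m t
    using that s by (intro interpolant_bounds mono conc \<phi>0; simp)+
  have cont: "isCont \<phi> t" if "0 < t" for t
  proof -
    have "convex_on {0<..} (\<lambda>t. - \<phi> t)"
      using conc unfolding concave_on_def by (rule convex_on_subset) auto
    then have "continuous_on {0<..} (\<lambda>t. - \<phi> t)"
      by (intro convex_on_continuous) auto
    then have "continuous_on {0<..} \<phi>" using continuous_on_minus by fastforce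
    then show ?thesis using that by (simp add: continuous_on_eq_continuous_at)
  qed
  have lim: "(\<lambda>m. interpolant \<phi> (M / Suc m) (Suc m) t) \<longlonglongrightarrow> \<phi> t" if t: "t \<in> {0<..s}" for t
  proof (rule tendsto_sandwich)
    have "(\<lambda>m. M * (1 / real (Suc m))) \<longlonglongrightarrow> M * 0"
      by (intro tendsto_intros lim_const_over_n[THEN filterlim_sequentially_Suc[THEN iffD2]])
    then have "(\<lambda>m. max 0 (t - M / real (Suc m))) \<longlonglongrightarrow> max 0 (t - 0)"
      by (intro tendsto_intros) auto
    then have "(\<lambda>m. max 0 (t - M / real (Suc m))) \<longlonglongrightarrow> t" using t by simp
    then show "(\<lambda>m. \<phi> (max 0 (t - M / Suc m))) \<longlonglongrightarrow> \<phi> t"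
      using t by (intro isCont_tendsto_compose[OF cont]) auto
  qed (use bounds t in auto)
  show ?thesis
    unfolding set_lebesgue_integral_def
  proof (rule integral_dominated_convergence)
    show "integrable lborel (\<lambda>t. indicat_real {0<..s} t *\<^sub>R (\<phi> t / t))"
      using int unfolding set_integrable_def .
    then show "(\<lambda>t. indicat_real {0<..s} t *\<^sub>R (\<phi> t / t)) \<in> borel_measurable lborel"
      by (rule borel_measurable_integrable)
    show "(\<lambda>t. indicat_real {0<..s} t *\<^sub>R (interpolant \<phi> (M / Suc m) (Suc m) t / t)) \<in> borel_measurable lborel" for m
      using integral_interpolant(1)[of "M / Suc m" s \<phi> "Suc m"] s
      unfolding set_integrable_def by (intro borel_measurable_integrable) simp
    show "AE t in lborel. (\<lambda>m. indicat_real {0<..s} t *\<^sub>R (interpolant \<phi> (M / Suc m) (Suc m) t / t))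
        \<longlonglongrightarrow> indicat_real {0<..s} t *\<^sub>R (\<phi> t / t)"
      using lim by (intro AE_I2) (auto split: split_indicator intro!: tendsto_intros)
    show "AE t in lborel. norm (indicat_real {0<..s} t *\<^sub>R (interpolant \<phi> (M / Suc m) (Suc m) t / t))
        \<le> indicat_real {0<..s} t *\<^sub>R (\<phi> t / t)" for m
    proof (intro AE_I2)
      fix t
      have "0 \<le> interpolant \<phi> (M / Suc m) (Suc m) t" if "t \<in> {0<..s}"
        using bounds(2)[OF that, of m] pos[of "max 0 (t - M / Suc m)"] by simp
      then show "norm (indicat_real {0<..s} t *\<^sub>R (interpolant \<phi> (M / Suc m) (Suc m) t / t))
        \<le> indicat_real {0<..s} t *\<^sub>R (\<phi> t / t)"
        using bounds(1)[of t m] by (auto split: split_indicator intro!: divide_right_mono)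
    qed
  qed
qed

lemma prec_L_iff_trunc_log_le:
  fixes x y :: "real ^ 'n"
  assumes x: "x \<in> nonneg_vecs" and y: "y \<in> nonneg_vecs"
  shows "x \<prec>\<^sub>L y \<longleftrightarrow> trunc_log_le x y"
proof
  assume "x \<prec>\<^sub>L y"
  then show "trunc_log_le x y"
    using log_primitive_trunc_log by (auto simp: prec_L_def trunc_log_le_def)
next
  assume le: "trunc_log_le x y"
  show "x \<prec>\<^sub>L y" unfolding prec_L_def
  proof (intro allI impI)
    fix \<psi> assume "log_primitive \<psi>"
    then obtain \<phi>' where pos: "\<And>t. 0 \<le> t \<Longrightarrow> 0 \<le> \<phi>' t" and mono': "mono_on {0..} \<phi>'"
      and conc': "concave_on {0..} \<phi>'"
      and int': "\<And>s. 0 \<le> s \<Longrightarrow> set_integrable lborel {0<..s} (\<lambda>t. \<phi>' t / t)"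
      and \<psi>': "\<And>s. 0 \<le> s \<Longrightarrow> \<psi> s = (LBINT t:{0<..s}. \<phi>' t / t)"
      unfolding log_primitive_def by blast
    define \<phi> where "\<phi> = \<phi>'(0 := 0)"
    have \<phi>0: "\<phi> 0 = 0" by (simp add: \<phi>_def)
    have mono: "mono_on {0..} \<phi>"
      using mono' pos unfolding \<phi>_def mono_on_def by auto
    have conc: "concave_on {0..} \<phi>"
      unfolding \<phi>_def by (rule concave_on_replace_at_0[OF conc' pos])
    have same: "(\<lambda>t. \<phi> t / t) = (\<lambda>t. \<phi>' t / t)" by (auto simp: \<phi>_def)
    \<comment> \<open>Strictly above all entries of both vectors, so that one grid on $[0, M]$ covers them all.\<close>
    define M where "M = (\<Sum>i\<in>UNIV. x $ i) + (\<Sum>i\<in>UNIV. y $ i) + 1"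
    have M: "x $ i < M" "y $ i < M" for i
      using x y member_le_sum[of i UNIV "\<lambda>i. x $ i"] member_le_sum[of i UNIV "\<lambda>i. y $ i"]
        sum_nonneg[of UNIV "\<lambda>i. x $ i"] sum_nonneg[of UNIV "\<lambda>i. y $ i"]
      by (auto simp: M_def nonneg_vecs_def)
    have lim: "(\<lambda>m. \<Sum>i\<in>UNIV. LBINT t:{0<..z $ i}. interpolant \<phi> (M / Suc m) (Suc m) t / t)
        \<longlonglongrightarrow> (\<Sum>i\<in>UNIV. \<psi> (z $ i))"
      if z: "z \<in> nonneg_vecs" "\<And>i. z $ i < M" for z :: "real ^ 'n"
    proof (rule tendsto_sum)
      fix i
      have "0 \<le> z $ i" using z by (simp add: nonneg_vecs_def)
      then show "(\<lambda>m. LBINT t:{0<..z $ i}. interpolant \<phi> (M / Suc m) (Suc m) t / t) \<longlonglongrightarrow> \<psi> (z $ i)"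
        unfolding \<psi>'[OF \<open>0 \<le> z $ i\<close>] same[symmetric]
        using int' z by (intro integral_interpolant_tendsto mono conc \<phi>0) (auto simp: same)
    qed
    have "0 < M" using M[of undefined] x by (auto simp: nonneg_vecs_def intro: le_less_trans)
    then show "(\<Sum>i\<in>UNIV. \<psi> (x $ i)) \<le> (\<Sum>i\<in>UNIV. \<psi> (y $ i))"
      by (intro LIMSEQ_le[OF lim[OF x M(1)] lim[OF y M(2)]] exI[of _ 0] allI impI
          sum_integral_interpolant_mono x y le mono conc) auto
  qed
qed

theorem theorem7:
  fixes x y :: "real ^ 'n"
  assumes "x \<in> nonneg_vecs" and "y \<in> nonneg_vecs"
  shows "(x \<prec>\<^sub>\<infinity> y \<longleftrightarrow> (\<forall>t>0. sup_prod x t \<le> sup_prod y t)) \<and>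
         ((\<forall>t>0. sup_prod x t \<le> sup_prod y t) \<longleftrightarrow> x \<prec>\<^sub>L y)"
  using prec_infty_iff_trunc_log_le[OF assms] sup_prod_le_iff_trunc_log_le[OF assms]
    prec_L_iff_trunc_log_le[OF assms] by blast

end
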